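(* Let $P$ be a finite partially ordered set with $n$ elements, let $Z_P$ be its zeta matrix and $\mathfrak{Z}_P = Z_P + Z_P^t$. For $1\le s\le n$ let $c_s$ be the number of collections of pairwise disjoint directed cycles in the directed graph $\overline{D_P}$ that consist of precisely $s$ cycles (i.e. have precisely $s$ connected components) and that together contain all the vertices of $\overline{D_P}$. Then $$\det(\mathfrak{Z}_P) = \sum_{s=1}^n (-1)^{n-s} c_s .$$
   Context: For a finite poset $P$ with $n$ elements labelled $x_1,\ldots,x_n$ so that $x_i < x_j$ implies $i<j$, the zeta matrix $Z_P$ is the $n\times n$ matrix with $(Z_P)_{ij}=1$ if $x_i\le x_j$ and $(Z_P)_{ij}=0$ otherwise; the superscript $t$ denotes transpose. The directed graph $D_P$ has vertex set $P$ and, for each pair of distinct comparable elements $x,y\in P$, one directed edge from $x$ to $y$ and one directed edge from $y$ to $x$; it has no loops. The directed graph $\overline{D_P}$ is obtained from $D_P$ by adding two (distinct) loops at each vertex. Directed cycles in $\overline{D_P}$ are simple directed cycles: a cycle of length $1$ is a loop (so each vertex carries two different cycles of length $1$), a cycle of length $2$ is $x\to y\to x$ for distinct comparable $x,y$, and for length at least $3$ the two orientations of a cyclic sequence of vertices count as different cycles. Cycles are disjoint if they share no vertices, and collections are unordered. *)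

theory Defs
  imports
    Graph_Theory.Arc_Walk
    Jordan_Normal_Form.Determinant
begin

text \<open>
  A poset is a carrier \<open>P\<close> with a relation \<open>r\<close> such that \<^const>\<open>partial_order_on\<close> holds, where
  \<open>(x, y) \<in> r\<close> stands for \<open>x \<le> y\<close>.  Labellings and matrix indices start at \<open>0\<close>.
\<close>

definition natural_labelling :: "'a set \<Rightarrow> 'a rel \<Rightarrow> nat \<Rightarrow> (nat \<Rightarrow> 'a) \<Rightarrow> bool" where
  "natural_labelling P r n x \<longleftrightarrow> bij_betw x {0..<n} P \<and>
     (\<forall>i<n. \<forall>j<n. (x i, x j) \<in> r \<and> x i \<noteq> x j \<longrightarrow> i < j)"

definition zeta_mat :: "'a rel \<Rightarrow> nat \<Rightarrow> (nat \<Rightarrow> 'a) \<Rightarrow> int mat" where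
  "zeta_mat r n x = mat n n (\<lambda>(i, j). if (x i, x j) \<in> r then 1 else 0)"

definition sym_zeta_mat :: "'a rel \<Rightarrow> nat \<Rightarrow> (nat \<Rightarrow> 'a) \<Rightarrow> int mat" where
  "sym_zeta_mat r n x = zeta_mat r n x + transpose_mat (zeta_mat r n x)"

text \<open>The Boolean argument distinguishes the two parallel loops at a vertex.\<close>

datatype 'a poset_arc = Edge 'a 'a | Loop 'a bool

fun arc_tail :: "'a poset_arc \<Rightarrow> 'a" where
  "arc_tail (Edge x y) = x"
| "arc_tail (Loop x b) = x"

fun arc_head :: "'a poset_arc \<Rightarrow> 'a" where
  "arc_head (Edge x y) = y"
| "arc_head (Loop x b) = x"

definition poset_digraph :: "'a set \<Rightarrow> 'a rel \<Rightarrow> ('a, 'a poset_arc) pre_digraph" where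
  "poset_digraph P r =
     \<lparr>verts = P,
      arcs = {Edge x y | x y. x \<in> P \<and> y \<in> P \<and> x \<noteq> y \<and> ((x, y) \<in> r \<or> (y, x) \<in> r)},
      tail = arc_tail, head = arc_head\<rparr>"

definition poset_digraph_loops :: "'a set \<Rightarrow> 'a rel \<Rightarrow> ('a, 'a poset_arc) pre_digraph" where
  "poset_digraph_loops P r =
     (poset_digraph P r)\<lparr>arcs := arcs (poset_digraph P r) \<union> {Loop x b | x b. x \<in> P}\<rparr>"

text \<open>
  \<^const>\<open>pre_digraph.cycle\<close> holds of arc lists with a chosen starting point.  Passing to the set
  of arcs forgets exactly the starting point: the arc set of a simple directed cycle determines
  its arc list up to rotation, while parallel loops and the two orientations of a cycle of
  length at least three have different arc sets.
\<close>

definition directed_cycles :: "('a, 'b) pre_digraph \<Rightarrow> 'b set set" where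
  "directed_cycles G = {set p | p. pre_digraph.cycle G p}"

definition cycle_verts :: "('a, 'b) pre_digraph \<Rightarrow> 'b set \<Rightarrow> 'a set" where
  "cycle_verts G c = tail G ` c"

definition cycle_covers :: "('a, 'b) pre_digraph \<Rightarrow> nat \<Rightarrow> 'b set set set" where
  "cycle_covers G s =
     {C. C \<subseteq> directed_cycles G \<and> finite C \<and> card C = s \<and>
         pairwise (\<lambda>c d. disjnt (cycle_verts G c) (cycle_verts G d)) C \<and>
         (\<Union>c\<in>C. cycle_verts G c) = verts G}"

definition num_cycle_covers :: "('a, 'b) pre_digraph \<Rightarrow> nat \<Rightarrow> nat" where
  "num_cycle_covers G s = card (cycle_covers G s)"

text \<open>For a finite poset the cardinality above is that of a finite set.\<close>

lemma finite_cycle_covers: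
  assumes "finite (arcs G)"
  shows "finite (cycle_covers G s)"
proof (rule finite_subset)
  show "cycle_covers G s \<subseteq> Pow (Pow (arcs G))"
    by (auto simp: cycle_covers_def directed_cycles_def pre_digraph.cycle_def
        pre_digraph.awalk_def)
qed (use assms in simp)

lemma finite_arcs_poset_digraph_loops:
  assumes "finite P"
  shows "finite (arcs (poset_digraph_loops P r))"
proof (rule finite_subset)
  show "arcs (poset_digraph_loops P r)
      \<subseteq> case_prod Edge ` (P \<times> P) \<union> case_prod Loop ` (P \<times> UNIV)"
    by (auto simp: poset_digraph_loops_def poset_digraph_def)
qed (use assms in simp)

end

theory Submission
  imports Defs "HOL-Combinatorics.Cycles" "HOL-Combinatorics.Orbits"
begin

text \<open>
  Every nonzero term of the Leibniz expansion belongs to a permutation \<open>\<pi>\<close> of \<open>P\<close> with \<open>v\<close> and \<open>\<pi> v\<close>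
  equal or comparable for all \<open>v\<close>, and by antisymmetry the entry at \<open>(v, \<pi> v)\<close> is the number of
  arcs from \<open>v\<close> to \<open>\<pi> v\<close>: two loops on the diagonal, one edge otherwise.  Hence the product of the
  entries counts the functions \<open>f\<close> choosing an arc \<open>f v\<close> from \<open>v\<close> to \<open>\<pi> v\<close> for every \<open>v\<close>.  Such a
  pair \<open>(\<pi>, f)\<close> is the same as a cycle cover, whose cycles are the images under \<open>f\<close> of the orbits
  of \<open>\<pi>\<close>; and \<open>\<pi>\<close> has sign \<open>(-1)^(n - s)\<close> when it has \<open>s\<close> orbits.
\<close>

section \<open>Orbits and the sign of a permutation\<close>

text \<open>The power \<open>f ^^ k\<close> acts on \<open>xs\<close> as the k-fold rotation, so
  iterating \<open>f\<close> from one entry runs through all entries and no others.\<close>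

lemma orbit_eq_set_if_rotates:
  assumes rot: "map f xs = rotate1 xs" and "a \<in> set xs"
  shows "orbit f a = set xs"
proof
  have rot_pow: "map (f ^^ k) xs = rotate k xs" for k
  proof (induction k)
    case (Suc k)
    have "map (f ^^ Suc k) xs = map f (map (f ^^ k) xs)" by simp
    also have "\<dots> = rotate k (rotate1 xs)" by (simp only: Suc rotate_map[symmetric] rot)
    finally show ?case by (simp only: rotate_Suc rotate1_rotate_swap)
  qed simp
  show "orbit f a \<subseteq> set xs"
  proof
    fix y assume "y \<in> orbit f a"
    then obtain k where "y = (f ^^ k) a" by (auto simp: orbit_altdef)
    then have "y \<in> set (map (f ^^ k) xs)" using \<open>a \<in> set xs\<close> by auto
    then show "y \<in> set xs" by (simp only: rot_pow set_rotate)
  qed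
  show "set xs \<subseteq> orbit f a"
  proof
    fix y assume "y \<in> set xs"
    then obtain i j where i: "i < length xs" "a = xs ! i" and j: "j < length xs" "y = xs ! j"
      using \<open>a \<in> set xs\<close> by (metis in_set_conv_nth)
    \<comment> \<open>The shift from position \<open>i\<close> to \<open>j\<close> modulo the
      length. The full turn added makes \<open>k\<close> positive, as \<open>orbit\<close> consists
      of the positive iterates.\<close>
    define k where "k = j + (length xs - i)"
    have "(f ^^ k) a = map (f ^^ k) xs ! i" using i by simp
    also have "\<dots> = xs ! ((k + i) mod length xs)"
      using i by (simp only: rot_pow nth_rotate)
    also have "(k + i) mod length xs = j" using i j by (simp add: k_def)
    finally have "y = (f ^^ k) a" using j by simp
    moreover have "0 < k" using i by (simp add: k_def)
    ultimately show "y \<in> orbit f a" by (auto simp: orbit_altdef)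
  qed
qed

text \<open>A cycle is a product of transpositions, one for each list entry after the first. For the
  empty list the truncated exponent is 0, the right value for the identity.\<close>

lemma sign_cycle_of_list:
  assumes "distinct cs"
  shows "sign (cycle_of_list cs) = (-1) ^ (length cs - 1)"
  using assms
proof (induction cs rule: cycle_of_list.induct)
  case (1 i j cs)
  have "sign (cycle_of_list (i # j # cs)) = sign (transpose i j) * sign (cycle_of_list (j # cs))"
    by (simp add: sign_compose permutation_swap_id permutation_of_cycle)
  then show ?case using 1 by (simp add: sign_swap_id del: cycle_of_list.simps)
qed simp_all

text \<open>Composing with a disjoint cycle of length l > 0 adds l points and one orbit and
  contributes l - 1 sign changes; l + 1 and l - 1 have the same parity. Adding the cardinalities
  instead of subtracting them avoids truncation in the induction.\<close>

lemma sign_cycle_decomp: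
  assumes "cycle_decomp I p"
  shows "finite I \<and> p permutes I \<and> sign p = (-1) ^ (card I + card (orbit p ` I))"
  using assms
proof (induction rule: cycle_decomp.induct)
  case (comp I p cs)
  let ?c = "cycle_of_list cs"
  have fin: "finite I" and p: "p permutes I"
    and sgn: "sign p = (-1) ^ (card I + card (orbit p ` I))" using comp.IH by auto
  have c: "?c permutes set cs" by (rule cycle_permutes)
  have perm: "?c \<circ> p permutes set cs \<union> I"
    by (rule permutes_compose) (use c p permutes_subset in blast)+
  have "permutation p" using fin p by (auto simp: permutation_permutes)
  then have sgn_comp: "sign (?c \<circ> p) = (-1) ^ (length cs - 1) * (-1) ^ (card I + card (orbit p ` I))"
    using sign_cycle_of_list[OF comp.hyps(2)] sgn by (simp add: sign_compose permutation_of_cycle)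
  have orbit_I: "orbit (?c \<circ> p) a = orbit p a" if "a \<in> I" for a
  proof (rule orbit_cong0[symmetric, OF that])
    show "p \<in> I \<rightarrow> I" using p by (auto simp: permutes_in_image)
    show "p b = (?c \<circ> p) b" if "b \<in> I" for b
    proof -
      have "p b \<notin> set cs" using that p comp.hyps(3) by (auto simp: permutes_in_image)
      then show ?thesis by (simp add: id_outside_supp)
    qed
  qed
  have orbit_cs: "orbit (?c \<circ> p) a = set cs" if "a \<in> set cs" for a
  proof (rule orbit_eq_set_if_rotates[OF _ that])
    have "map (?c \<circ> p) cs = map ?c cs"
      using comp.hyps(3) permutes_not_in[OF p] by (auto intro!: arg_cong[of _ _ ?c])
    also have "\<dots> = rotate1 cs" using cyclic_rotation[OF comp.hyps(2), of 1] by simp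
    finally show "map (?c \<circ> p) cs = rotate1 cs" .
  qed
  show ?case
  \<comment> \<open>\<open>cycle_decomp\<close> admits the empty list as a cycle; it contributes no
    orbit.\<close>
  proof (cases "cs = []")
    case True
    then show ?thesis using fin perm sgn by simp
  next
    case False
    have "orbit (?c \<circ> p) ` (set cs \<union> I) = insert (set cs) (orbit p ` I)"
      using False orbit_I orbit_cs by (auto simp: image_Un)
        (metis image_eqI list.set_intros(1) neq_Nil_conv)
    moreover have "set cs \<notin> orbit p ` I"
      using False comp.hyps(3) permutes_orbit_subset[OF p]
      by (metis Int_absorb2 imageE set_empty)
    moreover have "card (set cs \<union> I) = length cs + card I"
      using fin comp.hyps by (simp add: card_Un_disjoint distinct_card)
    ultimately have "card (set cs \<union> I) + card (orbit (?c \<circ> p) ` (set cs \<union> I))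
        = length cs - 1 + (card I + card (orbit p ` I)) + 2"
      using fin False by (simp add: Suc_leI)
    then have "sign (?c \<circ> p) = (-1) ^ (card (set cs \<union> I) + card (orbit (?c \<circ> p) ` (set cs \<union> I)))"
      unfolding sgn_comp by (simp add: power_add)
    then show ?thesis using fin perm by blast
  qed
qed (simp add: id_def[symmetric])

lemma sign_eq_card_orbits:
  assumes "p permutes S" "finite S"
  shows "sign p = (-1) ^ (card S - card (orbit p ` S))"
proof -
  have le: "card (orbit p ` S) \<le> card S" using assms(2) by (rule card_image_le)
  have "sign p = (-1) ^ (card S + card (orbit p ` S))"
    using sign_cycle_decomp[OF cycle_decomposition[OF assms]] by simp
  also have "card S + card (orbit p ` S) = card S - card (orbit p ` S) + 2 * card (orbit p ` S)"
    using le by simp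
  finally show ?thesis by (simp add: power_add)
qed

section \<open>Cycle covers as permutations with a choice of arcs\<close>

context fin_digraph
begin

definition arcs_between :: "'a \<Rightarrow> 'a \<Rightarrow> 'b set" where
  "arcs_between u v = {e \<in> arcs G. tail G e = u \<and> head G e = v}"

text \<open>The extensional product fixes the values off the vertices, so that distinct elements are
  distinct choices of arcs and \<open>card_PiE\<close> counts them.\<close>

definition arc_choices :: "('a \<Rightarrow> 'a) \<Rightarrow> ('a \<Rightarrow> 'b) set" where
  "arc_choices \<pi> = (\<Pi>\<^sub>E v\<in>verts G. arcs_between v (\<pi> v))"

definition orbit_arcs :: "('a \<Rightarrow> 'a) \<times> ('a \<Rightarrow> 'b) \<Rightarrow> 'b set set" where
  "orbit_arcs = (\<lambda>(\<pi>, f). (\<lambda>v. f ` orbit \<pi> v) ` verts G)"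

section \<open>Tails and heads along a directed cycle\<close>

lemma cycle_heads_rotate:
  assumes "cycle p"
  shows "map (head G) p = rotate1 (map (tail G) p)"
proof -
  obtain u where u: "awalk u p u" and "p \<noteq> []" using assms by (auto simp: cycle_def)
  have cas: "cas u p u" using u by (simp add: awalk_def)
  obtain e es where p: "p = e # es" using \<open>p \<noteq> []\<close> by (cases p) auto
  \<comment> \<open>Both sides spell out the vertex list of the closed walk, read once by heads and
    once by tails.\<close>
  have "tail G e # map (head G) p = map (tail G) p @ [head G (last p)]"
    using awalk_verts_conv'[OF cas] awalk_verts_conv[of u p] p by simp
  moreover have "head G (last p) = tail G e"
    using awlast_if_cas[OF cas] cas p by (simp add: awalk_verts_conv split: if_splits)
  ultimately show ?thesis using p by simp
qed

text \<open>The definition of \<open>cycle\<close> makes the heads distinct, and the tails are a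
  rotation of them.\<close>

lemma cycle_distinct_tails:
  assumes "cycle p"
  shows "distinct (map (tail G) p)"
proof -
  obtain u where u: "cas u p u" "p \<noteq> []" "distinct (tl (awalk_verts u p))"
    using assms by (auto simp: cycle_def awalk_def)
  then have "distinct (map (head G) p)" by (simp add: awalk_verts_conv')
  then show ?thesis by (simp add: cycle_heads_rotate[OF assms])
qed

lemma directed_cycles_inj_on_tail:
  "c \<in> directed_cycles G \<Longrightarrow> inj_on (tail G) c"
  by (auto simp: directed_cycles_def distinct_map dest: cycle_distinct_tails)

lemma directed_cycles_subset_arcs:
  "c \<in> directed_cycles G \<Longrightarrow> c \<subseteq> arcs G"
  by (auto simp: directed_cycles_def cycle_def awalk_def)

lemma directed_cycles_nonempty:
  "c \<in> directed_cycles G \<Longrightarrow> c \<noteq> {}"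
  by (auto simp: directed_cycles_def cycle_def)

lemma directed_cycles_heads:
  assumes "c \<in> directed_cycles G"
  shows "head G ` c = tail G ` c"
proof -
  obtain p where p: "c = set p" "cycle p" using assms by (auto simp: directed_cycles_def)
  have "set (map (head G) p) = set (map (tail G) p)"
      by (simp add: cycle_heads_rotate[OF p(2)] del: set_map)
  then show ?thesis by (simp add: p)
qed

text \<open>A function that follows the arcs of a cycle rotates its list of tails.\<close>

lemma directed_cycles_orbit:
  assumes "c \<in> directed_cycles G" "v \<in> tail G ` c"
    and \<pi>: "\<And>e. e \<in> c \<Longrightarrow> \<pi> (tail G e) = head G e"
  shows "orbit \<pi> v = tail G ` c"
proof -
  obtain p where p: "c = set p" "cycle p" using assms by (auto simp: directed_cycles_def)
  have "map \<pi> (map (tail G) p) = map (head G) p" using \<pi> p by simp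
  then have "orbit \<pi> v = set (map (tail G) p)"
    using orbit_eq_set_if_rotates[of \<pi> "map (tail G) p" v] assms(2) p
    by (simp add: cycle_heads_rotate)
  then show ?thesis by (simp add: p)
qed

section \<open>From permutations with arc choices to cycle covers and back\<close>

lemma arc_choicesD:
  assumes "f \<in> arc_choices \<pi>" "v \<in> verts G"
  shows "f v \<in> arcs G" "tail G (f v) = v" "head G (f v) = \<pi> v"
  using assms by (auto simp: arc_choices_def arcs_between_def PiE_def Pi_def)

lemma arc_choices_inj_on:
  "f \<in> arc_choices \<pi> \<Longrightarrow> inj_on f (verts G)"
  by (metis arc_choicesD(2) inj_onI)

text \<open>The list \<open>support \<pi> v\<close> runs through the orbit once, starting at
  \<open>v\<close>; the arcs chosen at its entries form a walk that closes up because
  \<open>least_power\<close> returns to \<open>v\<close>.\<close>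

lemma orbit_arcs_directed_cycle:
  assumes \<pi>: "\<pi> permutes verts G" and f: "f \<in> arc_choices \<pi>" and v: "v \<in> verts G"
  shows "f ` orbit \<pi> v \<in> directed_cycles G"
proof -
  have perm: "permutation \<pi>" using \<pi> finite_verts by (rule permutes_imp_permutation[rotated])
  define k where "k = least_power \<pi> v"
  define p where "p = map f (support \<pi> v)"
  have iter_in: "(\<pi> ^^ i) v \<in> verts G" for i
    using v by (simp add: permutes_in_image[OF permutes_funpow[OF \<pi>]])
  have cas: "cas v (map f (map (\<lambda>i. (\<pi> ^^ i) v) [0..<m])) ((\<pi> ^^ m) v)" for m
  proof (induction m)
    case (Suc m)
    show ?case using Suc awlast_if_cas[OF Suc] by (simp add: arc_choicesD[OF f iter_in])
  qed simp
  have "cas v p v"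
    using cas[of "least_power \<pi> v"] least_power_of_permutation(1)[OF perm] by (simp add: p_def)
  have "p \<noteq> []" using least_power_of_permutation(2)[OF perm, of v] by (simp add: p_def)
  have "set p \<subseteq> arcs G" by (auto simp: p_def arc_choicesD[OF f iter_in])
  have "map (head G) p = map \<pi> (support \<pi> v)"
    by (simp add: p_def arc_choicesD[OF f iter_in])
  moreover have "distinct (map \<pi> (support \<pi> v))"
    using cycle_of_permutation[OF perm, of v] permutes_inj[OF \<pi>]
    by (subst distinct_map) (auto intro: inj_on_subset)
  ultimately have "distinct (tl (awalk_verts v p))"
    using awalk_verts_conv'[OF \<open>cas v p v\<close>] \<open>p \<noteq> []\<close> by simp
  then have "cycle p"
    using \<open>cas v p v\<close> \<open>p \<noteq> []\<close> \<open>set p \<subseteq> arcs G\<close> v by (auto simp: cycle_def awalk_def)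
  moreover have "set p = f ` orbit \<pi> v"
    unfolding p_def set_map[of f] support_set[OF perm]
    by (auto simp: orbit_altdef_permutation[OF perm])
  ultimately show ?thesis by (auto simp: directed_cycles_def)
qed

text \<open>The tail of \<open>f v\<close> is \<open>v\<close>, so \<open>f\<close> is injective on
  the vertices and distinct orbits have distinct images.\<close>

lemma card_orbit_arcs:
  assumes \<pi>: "\<pi> permutes verts G" and f: "f \<in> arc_choices \<pi>"
  shows "card (orbit_arcs (\<pi>, f)) = card (orbit \<pi> ` verts G)"
proof -
  have "orbit_arcs (\<pi>, f) = (`) f ` (orbit \<pi> ` verts G)" by (auto simp: orbit_arcs_def)
  moreover have "inj_on ((`) f) (orbit \<pi> ` verts G)"
    by (rule inj_on_subset[OF inj_on_image_Pow[OF arc_choices_inj_on[OF f]]])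
      (use permutes_orbit_subset[OF \<pi>] in auto)
  ultimately show ?thesis by (simp add: card_image)
qed

lemma Union_orbit_arcs:
  assumes "\<pi> permutes verts G"
  shows "\<Union> (orbit_arcs (\<pi>, f)) = f ` verts G"
  using permutes_orbit_subset[OF assms] permutation_self_in_orbit[of \<pi>] assms finite_verts
  unfolding orbit_arcs_def permutation_permutes by fast

lemma cycle_verts_orbit_arc:
  assumes \<pi>: "\<pi> permutes verts G" and f: "f \<in> arc_choices \<pi>" and v: "v \<in> verts G"
  shows "cycle_verts G (f ` orbit \<pi> v) = orbit \<pi> v"
  using permutes_orbit_subset[OF \<pi> v] arc_choicesD(2)[OF f]
  by (force simp: cycle_verts_def image_image)

text \<open>Taking tails undoes \<open>f\<close>, so the vertex sets of the cycles are the orbits of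
  \<open>\<pi>\<close>, which partition the vertices.\<close>

lemma orbit_arcs_cover:
  assumes \<pi>: "\<pi> permutes verts G" and f: "f \<in> arc_choices \<pi>"
  shows "orbit_arcs (\<pi>, f) \<in> cycle_covers G (card (orbit \<pi> ` verts G))"
  unfolding cycle_covers_def
proof (intro CollectI conjI)
  show "orbit_arcs (\<pi>, f) \<subseteq> directed_cycles G"
    using orbit_arcs_directed_cycle[OF assms] by (auto simp: orbit_arcs_def)
  show "finite (orbit_arcs (\<pi>, f))" by (simp add: orbit_arcs_def)
  show "card (orbit_arcs (\<pi>, f)) = card (orbit \<pi> ` verts G)" by (rule card_orbit_arcs[OF assms])
  have perm: "permutation \<pi>" using \<pi> finite_verts by (rule permutes_imp_permutation[rotated])
  show "pairwise (\<lambda>c d. disjnt (cycle_verts G c) (cycle_verts G d)) (orbit_arcs (\<pi>, f))"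
  proof (rule pairwiseI)
    fix c d assume "c \<in> orbit_arcs (\<pi>, f)" "d \<in> orbit_arcs (\<pi>, f)" "c \<noteq> d"
    then obtain v w where c: "v \<in> verts G" "c = f ` orbit \<pi> v"
      and d: "w \<in> verts G" "d = f ` orbit \<pi> w" by (auto simp: orbit_arcs_def)
    have "orbit \<pi> v = orbit \<pi> w" if "z \<in> orbit \<pi> v" "z \<in> orbit \<pi> w" for z
      using that cyclic_on_orbit'[OF perm] orbit_cyclic_eq3 by metis
    then have "disjnt (orbit \<pi> v) (orbit \<pi> w)"
      using \<open>c \<noteq> d\<close> c d by (auto simp: disjnt_def)
    then show "disjnt (cycle_verts G c) (cycle_verts G d)"
      using c d by (simp add: cycle_verts_orbit_arc[OF assms])
  qed
  have "(\<Union>c\<in>orbit_arcs (\<pi>, f). cycle_verts G c) = tail G ` \<Union> (orbit_arcs (\<pi>, f))"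
    by (auto simp: cycle_verts_def)
  also have "\<dots> = verts G"
    using arc_choicesD(2)[OF f] by (simp add: Union_orbit_arcs[OF \<pi>] image_image)
  finally show "(\<Union>c\<in>orbit_arcs (\<pi>, f). cycle_verts G c) = verts G" .
qed

text \<open>The union of the cycles is the set of all chosen arcs. Their tails recover
  \<open>f\<close>, and the heads then recover \<open>\<pi>\<close>.\<close>

lemma inj_on_orbit_arcs:
  "inj_on orbit_arcs (SIGMA \<pi>:{\<pi>. \<pi> permutes verts G}. arc_choices \<pi>)"
proof (rule inj_onI, clarify)
  fix \<pi> f \<rho> g
  assume \<pi>: "\<pi> permutes verts G" and f: "f \<in> arc_choices \<pi>"
    and \<rho>: "\<rho> permutes verts G" and g: "g \<in> arc_choices \<rho>"
    and eq: "orbit_arcs (\<pi>, f) = orbit_arcs (\<rho>, g)"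
  have "f ` verts G = g ` verts G" using eq Union_orbit_arcs \<pi> \<rho> by metis
  have fg: "f v = g v" if "v \<in> verts G" for v
  proof -
    have "f v \<in> g ` verts G" using that \<open>f ` verts G = g ` verts G\<close> by blast
    then obtain w where w: "w \<in> verts G" "f v = g w" by auto
    then have "w = v" using that arc_choicesD(2)[OF f that] arc_choicesD(2)[OF g w(1)] by simp
    then show ?thesis using w by simp
  qed
  have "f = g"
    by (rule PiE_ext) (use f g fg in \<open>auto simp: arc_choices_def\<close>)
  moreover have "\<pi> v = \<rho> v" for v
    using fg arc_choicesD(3)[OF f] arc_choicesD(3)[OF g] permutes_not_in \<pi> \<rho> by metis
  ultimately show "\<pi> = \<rho> \<and> f = g" by auto
qed

text \<open>In a cover every vertex is the tail of exactly one arc, which gives \<open>f\<close>,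
  and the head of that arc gives \<open>\<pi>\<close>. On each cycle heads and tails form the same
  set, so \<open>\<pi>\<close> maps the finite vertex set onto itself and is a bijection.\<close>

lemma cover_in_orbit_arcs_image:
  assumes "C \<in> cycle_covers G s"
  shows "C \<in> orbit_arcs ` (SIGMA \<pi>:{\<pi>. \<pi> permutes verts G}. arc_choices \<pi>)"
proof -
  have cyc: "\<And>c. c \<in> C \<Longrightarrow> c \<in> directed_cycles G"
    and disj: "\<And>c d. c \<in> C \<Longrightarrow> d \<in> C \<Longrightarrow> c \<noteq> d \<Longrightarrow> tail G ` c \<inter> tail G ` d = {}"
    and cover: "tail G ` \<Union>C = verts G"
    using assms by (auto simp: cycle_covers_def cycle_verts_def pairwise_def disjnt_def image_Union)
  have inj: "inj_on (tail G) (\<Union>C)"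
  proof (rule inj_onI)
    fix d e assume "d \<in> \<Union>C" "e \<in> \<Union>C" and eq: "tail G d = tail G e"
    then obtain a b where ab: "a \<in> C" "d \<in> a" "b \<in> C" "e \<in> b" by auto
    then have "a = b" using disj[of a b] eq by force
    then show "d = e" using directed_cycles_inj_on_tail[OF cyc] ab eq by (meson inj_onD)
  qed
  \<comment> \<open>Distinct tails within a cycle and disjointness between cycles make this inverse
    well defined; \<open>restrict\<close> provides the extensionality required by
    \<open>arc_choices\<close>.\<close>
  define f where "f = restrict (the_inv_into (\<Union>C) (tail G)) (verts G)"
  define \<pi> where "\<pi> = (\<lambda>v. if v \<in> verts G then head G (f v) else v)"
  have f_tail: "f (tail G e) = e" if "e \<in> c" "c \<in> C" for e c
  proof -
    have "tail G e \<in> verts G" using that cover by auto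
    moreover have "the_inv_into (\<Union>C) (tail G) (tail G e) = e"
      using that by (intro the_inv_into_f_f[OF inj]) auto
    ultimately show ?thesis by (simp add: f_def)
  qed
  have \<pi>_tail: "\<pi> (tail G e) = head G e" if "e \<in> c" "c \<in> C" for e c
    using f_tail[OF that] that cover by (auto simp: \<pi>_def)
  have cover_obtain: "\<exists>c\<in>C. \<exists>e\<in>c. v = tail G e" if "v \<in> verts G" for v
    using that unfolding cover[symmetric] by blast
  have "\<pi> ` verts G = head G ` \<Union>C"
    unfolding cover[symmetric] image_image by (rule image_cong) (auto simp: \<pi>_tail)
  also have "\<dots> = (\<Union>c\<in>C. head G ` c)" by auto
  also have "\<dots> = (\<Union>c\<in>C. tail G ` c)" using directed_cycles_heads[OF cyc] by simp
  also have "\<dots> = verts G" unfolding cover[symmetric] by blast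
  finally have "bij_betw \<pi> (verts G) (verts G)"
    by (simp add: bij_betw_def eq_card_imp_inj_on)
  then have \<pi>: "\<pi> permutes verts G"
    by (rule bij_imp_permutes) (simp add: \<pi>_def)
  have f: "f \<in> arc_choices \<pi>"
    unfolding arc_choices_def
  proof (rule PiE_I)
    fix v assume "v \<in> verts G"
    then obtain c e where e: "c \<in> C" "e \<in> c" "v = tail G e" using cover_obtain by blast
    moreover have "e \<in> arcs G" using e directed_cycles_subset_arcs[OF cyc] by blast
    ultimately show "f v \<in> arcs_between v (\<pi> v)"
      using f_tail \<pi>_tail by (auto simp: arcs_between_def)
  qed (simp add: f_def)
  have orb: "f ` orbit \<pi> (tail G e) = c" if "e \<in> c" "c \<in> C" for e c
  proof -
    have "orbit \<pi> (tail G e) = tail G ` c"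
      using that by (intro directed_cycles_orbit[OF cyc]) (auto simp: \<pi>_tail)
    then show ?thesis using f_tail that by (simp add: image_image)
  qed
  have "orbit_arcs (\<pi>, f) = C"
  proof
    show "orbit_arcs (\<pi>, f) \<subseteq> C"
      using cover_obtain orb by (fastforce simp: orbit_arcs_def)
    show "C \<subseteq> orbit_arcs (\<pi>, f)"
    proof
      fix c assume c: "c \<in> C"
      then obtain e where e: "e \<in> c" using directed_cycles_nonempty[OF cyc] by auto
      then have "tail G e \<in> verts G" using c cover by auto
      then show "c \<in> orbit_arcs (\<pi>, f)" using orb[OF e c] by (auto simp: orbit_arcs_def)
    qed
  qed
  then show ?thesis using \<pi> f by force
qed

lemma bij_betw_orbit_arcs:
  "bij_betw orbit_arcs (SIGMA \<pi>:{\<pi>. \<pi> permutes verts G}. arc_choices \<pi>)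
     (\<Union>s\<le>card (verts G). cycle_covers G s)"
  unfolding bij_betw_def
proof (intro conjI equalityI subsetI)
  fix C assume "C \<in> orbit_arcs ` (SIGMA \<pi>:{\<pi>. \<pi> permutes verts G}. arc_choices \<pi>)"
  then show "C \<in> (\<Union>s\<le>card (verts G). cycle_covers G s)"
    using orbit_arcs_cover card_image_le[OF finite_verts] by fastforce
qed (use inj_on_orbit_arcs cover_in_orbit_arcs_image in auto)

text \<open>The left side is the Leibniz expansion for the matrix of arc multiplicities, written
  without a labelling. Each product counts arc choices, so the sum runs over pairs weighted by sign,
  and the bijection turns it into a sum over covers grouped by their number of cycles.\<close>

theorem sum_permutations_eq_cycle_covers:
  "(\<Sum>\<pi> | \<pi> permutes verts G. sign \<pi> * (\<Prod>v\<in>verts G. int (card (arcs_between v (\<pi> v)))))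
    = (\<Sum>s\<le>card (verts G). (-1) ^ (card (verts G) - s) * int (num_cycle_covers G s))"
proof -
  let ?V = "verts G" and ?n = "card (verts G)"
  let ?S = "SIGMA \<pi>:{\<pi>. \<pi> permutes verts G}. arc_choices \<pi>"
  have fin_perm: "finite {\<pi>. \<pi> permutes ?V}" by (simp add: finite_permutations)
  have fin_choices: "finite (arc_choices \<pi>)" for \<pi>
    unfolding arc_choices_def arcs_between_def by (rule finite_PiE) simp_all
  have "(\<Sum>\<pi> | \<pi> permutes ?V. sign \<pi> * (\<Prod>v\<in>?V. int (card (arcs_between v (\<pi> v)))))
      = (\<Sum>\<pi> | \<pi> permutes ?V. \<Sum>f\<in>arc_choices \<pi>. sign \<pi>)"
    by (simp add: arc_choices_def card_PiE mult.commute)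
  also have "\<dots> = (\<Sum>(\<pi>, f)\<in>?S. sign \<pi>)"
    using fin_perm fin_choices by (subst sum.Sigma) auto
  also have "\<dots> = (\<Sum>x\<in>?S. (-1) ^ (?n - card (orbit_arcs x)))"
    by (rule sum.cong) (auto simp: sign_eq_card_orbits card_orbit_arcs)
  also have "\<dots> = (\<Sum>C\<in>(\<Union>s\<le>?n. cycle_covers G s). (-1) ^ (?n - card C))"
    by (rule sum.reindex_bij_betw[OF bij_betw_orbit_arcs])
  also have "\<dots> = (\<Sum>s\<le>?n. \<Sum>C\<in>cycle_covers G s. (-1) ^ (?n - card C))"
    by (rule sum.UNION_disjoint) (auto simp: finite_cycle_covers, auto simp: cycle_covers_def)
  also have "\<dots> = (\<Sum>s\<le>?n. \<Sum>C\<in>cycle_covers G s. (-1) ^ (?n - s))"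
    by (intro sum.cong refl) (auto simp: cycle_covers_def)
  also have "\<dots> = (\<Sum>s\<le>?n. (-1) ^ (?n - s) * int (num_cycle_covers G s))"
    by (simp add: num_cycle_covers_def mult.commute)
  finally show ?thesis .
qed

text \<open>The empty collection covers no vertex; this lets the final sum start at 1.\<close>

lemma num_cycle_covers_0:
  assumes "verts G \<noteq> {}"
  shows "num_cycle_covers G 0 = 0"
proof -
  have "cycle_covers G 0 = {}" using assms by (auto simp: cycle_covers_def)
  then show ?thesis by (simp add: num_cycle_covers_def)
qed

end

section \<open>The determinant of the symmetrized zeta matrix\<close>

text \<open>Conjugation by the labelling, \<open>map_permutation\<close>, carries permutations of
  the indices bijectively to permutations of \<open>P\<close> and preserves the sign.\<close>

lemma det_reindex:
  fixes a :: "'a \<Rightarrow> 'a \<Rightarrow> int"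
  assumes x: "bij_betw x {0..<n} P"
  shows "det (mat n n (\<lambda>(i, j). a (x i) (x j)))
    = (\<Sum>\<pi> | \<pi> permutes P. sign \<pi> * (\<Prod>v\<in>P. a v (\<pi> v)))"
proof -
  let ?I = "{0..<n}"
  have inj: "inj_on x ?I" and img: "x ` ?I = P" using x by (auto simp: bij_betw_def)
  \<comment> \<open>This is the form in which \<open>bij_betw_permutations\<close> describes
    conjugation.\<close>
  have "map_permutation ?I x = (\<lambda>\<pi> v. if v \<in> P then x (\<pi> (inv_into ?I x v)) else v)"
    by (auto simp: fun_eq_iff map_permutation_def restrict_id_def img)
  then have bij: "bij_betw (map_permutation ?I x) {\<pi>. \<pi> permutes ?I} {\<pi>. \<pi> permutes P}"
    using bij_betw_permutations[OF x] by simp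
  have "det (mat n n (\<lambda>(i, j). a (x i) (x j)))
      = (\<Sum>q | q permutes ?I. sign q * (\<Prod>i\<in>?I. a (x i) (x (q i))))"
    by (subst det_def'[of _ n]) (auto intro!: sum.cong prod.cong simp: permutes_in_image)
  also have "\<dots> = (\<Sum>q | q permutes ?I. sign (map_permutation ?I x q) *
      (\<Prod>v\<in>P. a v (map_permutation ?I x q v)))"
  proof (rule sum.cong[OF refl])
    fix q assume "q \<in> {q. q permutes ?I}"
    then have "sign (map_permutation ?I x q) = sign q"
      using inj by (simp add: sign_map_permutation)
    moreover have "(\<Prod>v\<in>P. a v (map_permutation ?I x q v)) = (\<Prod>i\<in>?I. a (x i) (x (q i)))"
      using inj by (simp add: prod.reindex map_permutation_apply flip: img)
    ultimately show "sign q * (\<Prod>i\<in>?I. a (x i) (x (q i))) = sign (map_permutation ?I x q) *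
        (\<Prod>v\<in>P. a v (map_permutation ?I x q v))" by simp
  qed
  also have "\<dots> = (\<Sum>\<pi> | \<pi> permutes P. sign \<pi> * (\<Prod>v\<in>P. a v (\<pi> v)))"
    by (rule sum.reindex_bij_betw[OF bij])
  finally show ?thesis .
qed

lemma fin_digraph_poset_digraph_loops:
  assumes "finite P"
  shows "fin_digraph (poset_digraph_loops P r)"
  using assms finite_arcs_poset_digraph_loops[OF assms, of r]
  by unfold_locales (auto simp: poset_digraph_loops_def poset_digraph_def)

text \<open>On the diagonal reflexivity makes both summands 1, matching the two loops; elsewhere
  antisymmetry prevents both from being 1, matching the at most one edge from \<open>u\<close> to
  \<open>v\<close>.\<close>

lemma card_arcs_between_poset_digraph_loops:
  assumes "finite P" "partial_order_on P r" "u \<in> P" "v \<in> P"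
  shows "int (card (fin_digraph.arcs_between (poset_digraph_loops P r) u v))
    = (if (u, v) \<in> r then 1 else 0) + (if (v, u) \<in> r then 1 else 0)"
proof -
  interpret fin_digraph "poset_digraph_loops P r"
    using assms(1) by (rule fin_digraph_poset_digraph_loops)
  have antisym: "u = v" if "(u, v) \<in> r" "(v, u) \<in> r"
    using assms(2) that by (auto simp: partial_order_on_def dest: antisymD)
  show ?thesis
  proof (cases "u = v")
    case True
    have "arcs_between u v = {Loop u True, Loop u False}"
      unfolding arcs_between_def
      using True assms(3) by (auto simp: poset_digraph_loops_def poset_digraph_def)
    moreover have "(u, v) \<in> r"
      using True assms(2,3) by (auto simp: partial_order_on_def preorder_on_def refl_on_def)
    ultimately show ?thesis using True by simp
  next
    case False
    have "arcs_between u v = (if (u, v) \<in> r \<or> (v, u) \<in> r then {Edge u v} else {})"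
      unfolding arcs_between_def
      using False assms(3,4) by (auto simp: poset_digraph_loops_def poset_digraph_def)
    then show ?thesis using False antisym by auto
  qed
qed

theorem theorem2:
  fixes P :: "'a set" and r :: "'a rel" and n :: nat and x :: "nat \<Rightarrow> 'a"
  assumes "finite P" and "P \<noteq> {}" and "card P = n"
    and "partial_order_on P r"
    and "natural_labelling P r n x"
  shows "det (sym_zeta_mat r n x) =
    (\<Sum>s = 1..n. (-1) ^ (n - s) * int (num_cycle_covers (poset_digraph_loops P r) s))"
proof -
  let ?G = "poset_digraph_loops P r"
  let ?a = "\<lambda>u v. (if (u, v) \<in> r then 1 else 0) + (if (v, u) \<in> r then 1 else 0) :: int"
  interpret fin_digraph ?G
    using assms(1) by (rule fin_digraph_poset_digraph_loops)
  have verts: "verts ?G = P" by (simp add: poset_digraph_loops_def poset_digraph_def)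
  have x: "bij_betw x {0..<n} P" using assms(5) by (simp add: natural_labelling_def)
  have "sym_zeta_mat r n x = mat n n (\<lambda>(i, j). ?a (x i) (x j))"
    by (rule eq_matI) (auto simp: sym_zeta_mat_def zeta_mat_def)
  then have "det (sym_zeta_mat r n x) = (\<Sum>\<pi> | \<pi> permutes P. sign \<pi> * (\<Prod>v\<in>P. ?a v (\<pi> v)))"
    using det_reindex[OF x, of ?a] by simp
  also have "\<dots> = (\<Sum>\<pi> | \<pi> permutes P. sign \<pi> * (\<Prod>v\<in>P. int (card (arcs_between v (\<pi> v)))))"
    using assms(1,4)
    by (intro sum.cong prod.cong arg_cong2[where f = "(*)"] refl
        card_arcs_between_poset_digraph_loops[symmetric]) (auto simp: permutes_in_image)
  also have "\<dots> = (\<Sum>s\<le>n. (-1) ^ (n - s) * int (num_cycle_covers ?G s))"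
    using sum_permutations_eq_cycle_covers by (simp add: verts assms(3))
  \<comment> \<open>The term for \<open>s = 0\<close> vanishes because \<open>P\<close> is
    nonempty.\<close>
  also have "\<dots> = (\<Sum>s = 1..n. (-1) ^ (n - s) * int (num_cycle_covers ?G s))"
    using num_cycle_covers_0 assms(2)
    by (intro sum.mono_neutral_right) (auto simp: verts Suc_le_eq)
  finally show ?thesis .
qed

end
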